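(* For $n\ge 1$ let $P_n = (\{v_1,\ldots,v_n\},\{\{v_i,v_{i+1}\} \mid 1\le i<n\})$ be the path with $n$ vertices. Let $\xi\in\{\alpha,\beta,\chi,\omega\}$ be arbitrary. (1) $P_1$ is $\xi$-stable and $\beta$-vertex-stable, but not $\rho$-vertex-stable for any $\rho\in\{\chi,\alpha,\omega\}$. (2) $P_2$ is neither $\xi$-stable nor $\rho$-vertex-stable for any $\rho\in\{\beta,\chi,\omega\}$, but it is $\alpha$-vertex-stable. (3) $P_3$ is $\xi$-stable but not $\xi$-vertex-stable. (4) For $n\ge 4$: $P_n$ is $\chi$-stable and $\omega$-stable as well as $\chi$-vertex-stable and $\omega$-vertex-stable; $P_n$ is not $\beta$-vertex-stable; if $n$ is even, $P_n$ is neither $\alpha$-stable nor $\beta$-stable but is $\alpha$-vertex-stable; and if $n$ is odd, $P_n$ is $\alpha$-stable and $\beta$-stable but not $\alpha$-vertex-stable.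
   Context: Graphs are finite, undirected, simple, without loops; the null graph (no vertices) is allowed. $\alpha(G)$ is the size of a maximum independent set, $\beta(G)$ the size of a minimum vertex cover, $\omega(G)$ the size of a maximum clique, $\chi(G)$ the chromatic number; all are $0$ on the null graph. For a parameter $\xi$, $G$ is $\xi$-stable if $\xi(G-e)=\xi(G)$ for every edge $e\in E(G)$ ($G-e$ is $G$ with $e$ deleted), and $\xi$-vertex-stable if $\xi(G-v)=\xi(G)$ for every vertex $v\in V(G)$ ($G-v$ is $G$ with $v$ and its incident edges deleted). *)

theory Defs
  imports Main
begin

text \<open>
  A graph is a pair of a vertex set and a set of edges, each edge being a two-element vertex set.
  The parameters below are total functions; they have their usual meaning on
  pairs satisfying \<open>simple_graph\<close>.
\<close>

type_synonym 'a graph = "'a set \<times> 'a set set"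

abbreviation verts :: "'a graph \<Rightarrow> 'a set" where
  "verts G \<equiv> fst G"

abbreviation edges :: "'a graph \<Rightarrow> 'a set set" where
  "edges G \<equiv> snd G"

definition simple_graph :: "'a graph \<Rightarrow> bool" where
  "simple_graph G \<longleftrightarrow> finite (verts G) \<and> (\<forall>e\<in>edges G. e \<subseteq> verts G \<and> card e = 2)"

definition independent_set :: "'a graph \<Rightarrow> 'a set \<Rightarrow> bool" where
  "independent_set G S \<longleftrightarrow> S \<subseteq> verts G \<and> (\<forall>u\<in>S. \<forall>v\<in>S. {u, v} \<notin> edges G)"

definition vertex_cover :: "'a graph \<Rightarrow> 'a set \<Rightarrow> bool" where
  "vertex_cover G C \<longleftrightarrow> C \<subseteq> verts G \<and> (\<forall>e\<in>edges G. e \<inter> C \<noteq> {})"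

definition clique :: "'a graph \<Rightarrow> 'a set \<Rightarrow> bool" where
  "clique G K \<longleftrightarrow> K \<subseteq> verts G \<and> (\<forall>u\<in>K. \<forall>v\<in>K. u \<noteq> v \<longrightarrow> {u, v} \<in> edges G)"

definition proper_colouring :: "'a graph \<Rightarrow> nat \<Rightarrow> ('a \<Rightarrow> nat) \<Rightarrow> bool" where
  "proper_colouring G k c \<longleftrightarrow>
     (\<forall>v\<in>verts G. c v < k) \<and>
     (\<forall>u\<in>verts G. \<forall>v\<in>verts G. {u, v} \<in> edges G \<longrightarrow> c u \<noteq> c v)"

definition alpha :: "'a graph \<Rightarrow> nat" where
  "alpha G = Max (card ` {S. independent_set G S})"

definition beta :: "'a graph \<Rightarrow> nat" where
  "beta G = Min (card ` {C. vertex_cover G C})"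

definition omega :: "'a graph \<Rightarrow> nat" where
  "omega G = Max (card ` {K. clique G K})"

definition chi :: "'a graph \<Rightarrow> nat" where
  "chi G = (LEAST k. \<exists>c. proper_colouring G k c)"

definition delete_edge :: "'a graph \<Rightarrow> 'a set \<Rightarrow> 'a graph" where
  "delete_edge G e = (verts G, edges G - {e})"

definition delete_vertex :: "'a graph \<Rightarrow> 'a \<Rightarrow> 'a graph" where
  "delete_vertex G v = (verts G - {v}, {e \<in> edges G. v \<notin> e})"

definition edge_stable :: "('a graph \<Rightarrow> nat) \<Rightarrow> 'a graph \<Rightarrow> bool" where
  "edge_stable \<xi> G \<longleftrightarrow> (\<forall>e\<in>edges G. \<xi> (delete_edge G e) = \<xi> G)"

definition vertex_stable :: "('a graph \<Rightarrow> nat) \<Rightarrow> 'a graph \<Rightarrow> bool" where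
  "vertex_stable \<xi> G \<longleftrightarrow> (\<forall>v\<in>verts G. \<xi> (delete_vertex G v) = \<xi> G)"

definition path_graph :: "nat \<Rightarrow> nat graph" where
  "path_graph n = ({1..n}, {{i, i + 1} | i. 1 \<le> i \<and> i < n})"

lemma simple_graph_path_graph: "simple_graph (path_graph n)"
  by (auto simp: simple_graph_def path_graph_def)

lemma simple_graph_delete_edge: "simple_graph G \<Longrightarrow> simple_graph (delete_edge G e)"
  by (auto simp: simple_graph_def delete_edge_def)

lemma simple_graph_delete_vertex: "simple_graph G \<Longrightarrow> simple_graph (delete_vertex G v)"
  by (auto simp: simple_graph_def delete_vertex_def)

lemma parameters_null_graph:
  "alpha ({}, {}) = 0" "beta ({}, {}) = 0" "chi ({}, {}) = 0" "omega ({}, {}) = 0"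
  by (simp_all add: alpha_def beta_def chi_def omega_def
      independent_set_def vertex_cover_def clique_def proper_colouring_def)

end

theory Submission
  imports Defs
begin

text \<open>
  Deleting an edge or a vertex of a path leaves two disjoint, possibly empty, paths. On a disjoint
  union of paths with \<open>p\<close> and \<open>q\<close> vertices, all four parameters have a closed form in \<open>p\<close> and \<open>q\<close>:
  an independent set and a partition into cliques of the same size certify \<open>\<alpha>\<close>, the Gallai
  identity \<open>\<alpha> + \<beta> = |V|\<close> then gives \<open>\<beta>\<close>, and a clique and a proper colouring of the same size certify
  \<open>\<omega>\<close> and \<open>\<chi>\<close> together. All claims become arithmetic.
\<close>

section \<open>Certificates for the parameters\<close>

text \<open>A proper colouring is injective on a clique, so no clique has more vertices than a
  proper colouring has colours; a clique and a colouring that meet this bound are both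
  optimal.\<close>

lemma chi_omega_eqI:
  assumes fin: "finite (verts G)" and K: "clique G K" and c: "proper_colouring G (card K) c"
  shows "chi G = card K" "omega G = card K"
proof -
  have le: "card L \<le> k" if L: "clique G L" and d: "proper_colouring G k d" for L k d
  proof -
    have "inj_on d L"
      using L d unfolding clique_def proper_colouring_def inj_on_def by blast
    moreover have "d ` L \<subseteq> {..<k}"
      using L d unfolding clique_def proper_colouring_def by blast
    ultimately show ?thesis
      using card_inj_on_le[of d L "{..<k}"] by simp
  qed
  show "chi G = card K"
    unfolding chi_def using c le[OF K] by (intro Least_equality) blast+
  have "finite {L. clique G L}"
    by (rule finite_subset[of _ "Pow (verts G)"]) (auto simp: clique_def fin)
  then show "omega G = card K"
    unfolding omega_def using K le[OF _ c] by (intro Max_eqI) auto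
qed

text \<open>The fibres of \<open>f\<close> form a partition of the vertices into cliques.\<close>

lemma alpha_eqI:
  assumes fin: "finite (verts G)" and S: "independent_set G S"
    and f: "\<And>u v. u \<in> verts G \<Longrightarrow> v \<in> verts G \<Longrightarrow> u \<noteq> v \<Longrightarrow> f u = f v \<Longrightarrow> {u, v} \<in> edges G"
    and B: "f ` verts G \<subseteq> B" "finite B" "card B = card S"
  shows "alpha G = card S"
proof -
  have le: "card T \<le> card S" if T: "independent_set G T" for T
  proof -
    have "inj_on f T"
      using T f unfolding independent_set_def inj_on_def by blast
    moreover have "f ` T \<subseteq> B"
      using T B unfolding independent_set_def by blast
    ultimately show ?thesis
      using card_inj_on_le[of f T B] B by simp
  qed
  have "finite {T. independent_set G T}"
    by (rule finite_subset[of _ "Pow (verts G)"]) (auto simp: independent_set_def fin)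
  then show ?thesis
    unfolding alpha_def using S le by (intro Max_eqI) auto
qed

section \<open>Gallai's identity\<close>

lemma vertex_cover_Diff_independent_set:
  assumes "simple_graph G" "independent_set G S"
  shows "vertex_cover G (verts G - S)"
proof -
  have "e \<inter> (verts G - S) \<noteq> {}" if e: "e \<in> edges G" for e
  proof -
    obtain u v where "e = {u, v}" "e \<subseteq> verts G"
      using assms(1) e unfolding simple_graph_def by (metis card_2_iff)
    then show ?thesis
      using assms(2) e unfolding independent_set_def by blast
  qed
  then show ?thesis
    unfolding vertex_cover_def by blast
qed

lemma independent_set_Diff_vertex_cover:
  assumes "vertex_cover G C"
  shows "independent_set G (verts G - C)"
  using assms unfolding vertex_cover_def independent_set_def by fast

text \<open>Complementation exchanges independent sets and vertex covers, so a largest independent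
  set leaves a smallest cover. Solved for \<open>beta\<close>, the identity serves as a rewrite
  rule.\<close>

lemma gallai_identity:
  assumes G: "simple_graph G"
  shows "beta G = card (verts G) - alpha G"
proof -
  let ?I = "{S. independent_set G S}" and ?C = "{C. vertex_cover G C}"
  have fin: "finite (verts G)"
    using G by (simp add: simple_graph_def)
  have finI: "finite (card ` ?I)"
    by (rule finite_imageI, rule finite_subset[of _ "Pow (verts G)"])
      (auto simp: independent_set_def fin)
  have finC: "finite (card ` ?C)"
    by (rule finite_imageI, rule finite_subset[of _ "Pow (verts G)"])
      (auto simp: vertex_cover_def fin)
  have "independent_set G {}"
    by (simp add: independent_set_def)
  then have "card ` ?I \<noteq> {}"
    by blast
  with finI have "alpha G \<in> card ` ?I"
    unfolding alpha_def by (rule Max_in)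
  then obtain S where S: "independent_set G S" "card S = alpha G"
    by auto
  have "card (verts G - S) = card (verts G) - alpha G"
    using S fin by (metis card_Diff_subset finite_subset independent_set_def)
  then have "card (verts G) - alpha G \<in> card ` ?C"
    using vertex_cover_Diff_independent_set[OF G S(1)] by (metis imageI mem_Collect_eq)
  moreover have "card (verts G) - alpha G \<le> card C" if C: "vertex_cover G C" for C
  proof -
    have "card (verts G - C) \<le> alpha G"
      unfolding alpha_def
      using independent_set_Diff_vertex_cover[OF C] by (intro Max_ge[OF finI]) blast
    moreover have "card (verts G - C) = card (verts G) - card C"
      using C fin by (metis card_Diff_subset finite_subset vertex_cover_def)
    ultimately show ?thesis
      by linarith
  qed
  ultimately show ?thesis
    unfolding beta_def using finC by (intro Min_eqI) auto
qed

section \<open>Parity arithmetic\<close>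

text \<open>Used to see that two vertices in the same class of the clique partition are
  neighbours.\<close>

lemma div_2_eq_imp:
  fixes k l :: nat
  assumes "k div 2 = l div 2"
  shows "k = l \<or> k = l + 1 \<or> l = k + 1"
  using assms div_mult_mod_eq[of k 2] div_mult_mod_eq[of l 2]
    mod_less_divisor[of 2 k] mod_less_divisor[of 2 l]
  by linarith

text \<open>For \<open>k = i\<close> and \<open>l = n - i\<close>, the first fact concerns
  \<open>alpha\<close> after deleting vertex \<open>i\<close>, the other two \<open>alpha\<close>
  and \<open>beta\<close> after deleting the edge from \<open>i\<close> to
  \<open>i + 1\<close>.\<close>

lemma add_div_2_parity:
  fixes k l :: nat
  shows "even (k + l) \<Longrightarrow> k div 2 + (l + 1) div 2 = (k + l + 1) div 2"
    and "odd (k + l) \<Longrightarrow> (k + 1) div 2 + (l + 1) div 2 = (k + l + 1) div 2"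
    and "odd (k + l) \<Longrightarrow> k div 2 + l div 2 = (k + l) div 2"
  by (cases "even k"; cases "even l"; auto elim!: evenE oddE)+

section \<open>Paths with an edge or a vertex deleted\<close>

text \<open>
  The cases \<open>a = b\<close> and \<open>b = a + 1\<close> are the path on \<open>1, \<dots>, n\<close> with an edge and with a vertex
  deleted; \<open>a = b = n\<close> is the whole path.
\<close>

definition split_path :: "nat \<Rightarrow> nat \<Rightarrow> nat \<Rightarrow> nat graph" where
  "split_path a b n = ({1..a} \<union> {b<..n}, {{i, i + 1} | i. 1 \<le> i \<and> i < n \<and> \<not> (a \<le> i \<and> i \<le> b)})"

lemma edge_split_path_iff:
  "{u, v} \<in> edges (split_path a b n) \<longleftrightarrow>
     (v = u + 1 \<and> 1 \<le> u \<and> u < n \<and> \<not> (a \<le> u \<and> u \<le> b)) \<or>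
     (u = v + 1 \<and> 1 \<le> v \<and> v < n \<and> \<not> (a \<le> v \<and> v \<le> b))"
  by (auto simp: split_path_def doubleton_eq_iff)

lemma path_graph_eq_split_path: "path_graph n = split_path n n n"
proof -
  have "i < n \<and> \<not> (n \<le> i \<and> i \<le> n) \<longleftrightarrow> i < n" for i
    by auto
  then show ?thesis
    by (simp add: path_graph_def split_path_def)
qed

lemma delete_edge_path_graph:
  assumes "1 \<le> i" "i < n"
  shows "delete_edge (path_graph n) {i, i + 1} = split_path i i n"
proof -
  have "{j, j + 1} = {i, i + 1} \<longleftrightarrow> i \<le> j \<and> j \<le> i" for j
    by (simp only: doubleton_eq_iff) linarith
  then have "{{j, j + 1} |j. 1 \<le> j \<and> j < n} - {{i, i + 1}} =
      {{j, j + 1} |j. 1 \<le> j \<and> j < n \<and> \<not> (i \<le> j \<and> j \<le> i)}"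
    by blast
  moreover have "{1..n} = {1..i} \<union> {i<..n}"
    using assms by auto
  ultimately show ?thesis
    by (simp add: path_graph_def delete_edge_def split_path_def)
qed

text \<open>Only edges with index \<open>i - 1\<close> or \<open>i\<close> contain \<open>i\<close>,
  which gives this gap. For \<open>i = 1\<close> or \<open>i = n\<close> at least one of the two
  remaining paths is empty.\<close>

lemma delete_vertex_path_graph:
  assumes "i \<in> {1..n}"
  shows "delete_vertex (path_graph n) i = split_path (i - 1) i n"
proof -
  have "{e \<in> edges (path_graph n). i \<notin> e} = edges (split_path (i - 1) i n)"
    using assms by (fastforce simp: path_graph_def split_path_def)
  moreover have "verts (path_graph n) - {i} = verts (split_path (i - 1) i n)"
    using assms by (auto simp: path_graph_def split_path_def)
  ultimately show ?thesis
    by (simp add: delete_vertex_def prod_eq_iff)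
qed

lemma edge_stable_path_graph_iff:
  "edge_stable \<xi> (path_graph n) \<longleftrightarrow> (\<forall>i. 1 \<le> i \<and> i < n \<longrightarrow> \<xi> (split_path i i n) = \<xi> (split_path n n n))"
proof -
  have "edges (path_graph n) = (\<lambda>i. {i, i + 1}) ` {i. 1 \<le> i \<and> i < n}"
    unfolding path_graph_def snd_conv by blast
  then have "edge_stable \<xi> (path_graph n) \<longleftrightarrow>
      (\<forall>i. 1 \<le> i \<and> i < n \<longrightarrow> \<xi> (delete_edge (path_graph n) {i, i + 1}) = \<xi> (path_graph n))"
    unfolding edge_stable_def by simp
  also have "\<dots> \<longleftrightarrow> (\<forall>i. 1 \<le> i \<and> i < n \<longrightarrow> \<xi> (split_path i i n) = \<xi> (path_graph n))"
    by (simp only: delete_edge_path_graph cong: conj_cong imp_cong)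
  finally show ?thesis
    unfolding path_graph_eq_split_path .
qed

lemma vertex_stable_path_graph_iff:
  "vertex_stable \<xi> (path_graph n) \<longleftrightarrow> (\<forall>i\<in>{1..n}. \<xi> (split_path (i - 1) i n) = \<xi> (split_path n n n))"
proof -
  have "verts (path_graph n) = {1..n}"
    by (simp add: path_graph_def)
  then have "vertex_stable \<xi> (path_graph n) \<longleftrightarrow>
      (\<forall>i\<in>{1..n}. \<xi> (delete_vertex (path_graph n) i) = \<xi> (path_graph n))"
    unfolding vertex_stable_def by simp
  also have "\<dots> \<longleftrightarrow> (\<forall>i\<in>{1..n}. \<xi> (split_path (i - 1) i n) = \<xi> (path_graph n))"
    by (intro ball_cong refl) (metis delete_vertex_path_graph)
  finally show ?thesis
    unfolding path_graph_eq_split_path .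
qed

section \<open>The parameters on two disjoint paths\<close>

context
  fixes a b n :: nat
  assumes ab: "a \<le> b" and bn: "b \<le> n"
begin

lemma simple_graph_split_path: "simple_graph (split_path a b n)"
proof -
  \<comment> \<open>An index outside the gap is below \<open>a\<close> or above \<open>b\<close>, so
    both ends of its edge lie on the same path.\<close>
  have "{i, i + 1} \<subseteq> {1..a} \<union> {b<..n} \<and> card {i, i + 1} = 2"
    if "1 \<le> i" "i < n" "\<not> (a \<le> i \<and> i \<le> b)" for i
    using that ab by auto
  then show ?thesis
    unfolding simple_graph_def split_path_def by fastforce
qed

lemma card_verts_split_path: "card (verts (split_path a b n)) = a + (n - b)"
proof -
  have "card ({1..a} \<union> {b<..n}) = card {1..a} + card {b<..n}"
    using ab by (intro card_Un_disjoint) auto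
  then show ?thesis
    by (simp add: split_path_def)
qed

lemma chi_omega_split_path:
  "chi (split_path a b n) = min 2 (max a (n - b))"
  "omega (split_path a b n) = min 2 (max a (n - b))"
proof -
  let ?k = "min 2 (max a (n - b))"
  \<comment> \<open>\<open>?s\<close> is the offset of a longest path, and \<open>?K\<close>
    consists of its first \<open>?k\<close> vertices: none, one, or two adjacent ones.\<close>
  let ?s = "if n - b \<le> a then 0 else b"
  let ?K = "{?s<..?s + ?k}"
  have fin: "finite (verts (split_path a b n))"
    by (simp add: split_path_def)
  have "?K \<subseteq> verts (split_path a b n)"
    using ab bn by (auto simp: split_path_def)
  moreover have "{u, v} \<in> edges (split_path a b n)" if "u \<in> ?K" "v \<in> ?K" "u \<noteq> v" for u v
    using that ab bn unfolding edge_split_path_iff by (auto split: if_splits)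
  ultimately have K: "clique (split_path a b n) ?K"
    unfolding clique_def by blast
  \<comment> \<open>A vertex forces \<open>?k\<close> to be positive and an edge forces it to be 2;
    then neighbours differ in parity.\<close>
  have "v mod ?k < ?k" if "v \<in> verts (split_path a b n)" for v
    using that by (intro mod_less_divisor) (auto simp: split_path_def)
  moreover have "u mod ?k \<noteq> v mod ?k" if "{u, v} \<in> edges (split_path a b n)" for u v
  proof -
    have "?k = 2"
      using that ab bn unfolding edge_split_path_iff by auto
    moreover have "v = u + 1 \<or> u = v + 1"
      using that unfolding edge_split_path_iff by blast
    then have "u mod 2 \<noteq> v mod 2"
      by (metis Suc_eq_plus1 even_Suc even_iff_mod_2_eq_zero)
    ultimately show ?thesis
      by simp
  qed
  ultimately have c: "proper_colouring (split_path a b n) (card ?K) (\<lambda>v. v mod ?k)"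
    unfolding proper_colouring_def by simp
  show "chi (split_path a b n) = ?k" "omega (split_path a b n) = ?k"
    using chi_omega_eqI[OF fin K c] by simp_all
qed

lemma alpha_split_path: "alpha (split_path a b n) = (a + 1) div 2 + (n - b + 1) div 2"
proof -
  let ?p = "(a + 1) div 2" and ?q = "(n - b + 1) div 2"
  \<comment> \<open>The vertices at odd positions, counted from the start of each path.\<close>
  let ?A = "(\<lambda>k. 2 * k + 1) ` {..<?p}" and ?B = "(\<lambda>k. b + 2 * k + 1) ` {..<?q}"
  \<comment> \<open>\<open>f\<close> numbers the cliques: consecutive vertices are paired from the
    start of each path, an odd path ending in a single vertex. The shift by \<open>?p\<close> keeps
    the two paths apart.\<close>
  define f where "f j = (if j \<le> a then (j + 1) div 2 else ?p + (j - b + 1) div 2)" for j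
  have fin: "finite (verts (split_path a b n))"
    by (simp add: split_path_def)
  have A: "i \<le> a \<and> odd i" if "i \<in> ?A" for i
    using that by auto
  have B: "b < i \<and> i \<le> n \<and> odd (i - b)" if "i \<in> ?B" for i
    using that by auto
  have "card ?A = ?p" "card ?B = ?q"
    by (simp_all add: card_image inj_on_def)
  moreover have "?A \<inter> ?B = {}"
    using A B ab by fastforce
  ultimately have card: "card (?A \<union> ?B) = ?p + ?q"
    by (simp add: card_Un_disjoint)
  have sub: "?A \<union> ?B \<subseteq> verts (split_path a b n)"
    using ab by (auto simp: split_path_def)
  have nonadj: "\<not> (v = u + 1 \<and> \<not> (a \<le> u \<and> u \<le> b))" if "u \<in> ?A \<union> ?B" "v \<in> ?A \<union> ?B" for u v
  proof -
    have "(i \<le> a \<and> odd i) \<or> (b < i \<and> odd (i - b))" if "i \<in> ?A \<union> ?B" for i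
      using that A B by blast
    from this[OF that(1)] this[OF that(2)] show ?thesis
      using ab by (auto simp: Suc_diff_le)
  qed
  have S: "independent_set (split_path a b n) (?A \<union> ?B)"
    unfolding independent_set_def
  proof (intro conjI ballI sub)
    fix u v
    assume "u \<in> ?A \<union> ?B" "v \<in> ?A \<union> ?B"
    then show "{u, v} \<notin> edges (split_path a b n)"
      using nonadj[of u v] nonadj[of v u] by (simp only: edge_split_path_iff) argo
  qed
  have V: "(1 \<le> u \<and> u \<le> a) \<or> (a < u \<and> b < u \<and> u \<le> n)" if "u \<in> verts (split_path a b n)" for u
    using that ab by (auto simp: split_path_def)
  have low: "1 \<le> f u \<and> f u \<le> ?p" if "1 \<le> u" "u \<le> a" for u
    using that by (simp add: f_def div_le_mono)
  have high: "?p < f u \<and> f u \<le> ?p + ?q" if "a < u" "b < u" "u \<le> n" for u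
  proof -
    \<comment> \<open>Positions on the second path start at 1, so its clique numbers start at
      \<open>?p + 1\<close>; writing 1 as \<open>2 div 2\<close> lets monotonicity give both
      bounds.\<close>
    have "(2::nat) div 2 \<le> (u - b + 1) div 2" "(u - b + 1) div 2 \<le> ?q"
      using that by (intro div_le_mono; simp)+
    then show ?thesis
      using that by (simp add: f_def)
  qed
  have side: "f u \<le> ?p \<longleftrightarrow> u \<le> a" if "u \<in> verts (split_path a b n)" for u
    using V[OF that] low[of u] high[of u] by (meson not_le)
  have f: "{u, v} \<in> edges (split_path a b n)"
    if u: "u \<in> verts (split_path a b n)" and v: "v \<in> verts (split_path a b n)"
      and neq: "u \<noteq> v" and eq: "f u = f v" for u v
  proof -
    have "u \<le> a \<longleftrightarrow> v \<le> a"
      using side[OF u] side[OF v] eq by simp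
    then consider "1 \<le> u" "u \<le> a" "1 \<le> v" "v \<le> a"
      | "a < u" "b < u" "u \<le> n" "a < v" "b < v" "v \<le> n"
      using V[OF u] V[OF v] by force
    then show ?thesis
    proof cases
      case 1
      then have "(u + 1) div 2 = (v + 1) div 2"
        using eq by (simp add: f_def)
      with div_2_eq_imp[of "u + 1" "v + 1"] neq have "v = u + 1 \<or> u = v + 1"
        by auto
      with 1 ab bn show ?thesis
        unfolding edge_split_path_iff by auto
    next
      case 2
      then have "(u - b + 1) div 2 = (v - b + 1) div 2"
        using eq by (simp add: f_def)
      with div_2_eq_imp[of "u - b + 1" "v - b + 1"] neq 2 have "v = u + 1 \<or> u = v + 1"
        by auto
      with 2 show ?thesis
        unfolding edge_split_path_iff by auto
    qed
  qed
  have img: "f ` verts (split_path a b n) \<subseteq> {1..?p + ?q}"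
  proof (rule image_subsetI)
    fix u
    assume "u \<in> verts (split_path a b n)"
    with V[of u] low[of u] high[of u] have "1 \<le> f u \<and> f u \<le> ?p + ?q"
      by auto
    then show "f u \<in> {1..?p + ?q}"
      unfolding atLeastAtMost_iff .
  qed
  have "card {1..?p + ?q} = card (?A \<union> ?B)"
    unfolding card by simp
  with fin S f img have "alpha (split_path a b n) = card (?A \<union> ?B)"
    by (intro alpha_eqI[where f = f and B = "{1..?p + ?q}"] finite_atLeastAtMost)
  with card show ?thesis
    by (simp only:)
qed

lemma beta_split_path: "beta (split_path a b n) = a div 2 + (n - b) div 2"
  unfolding gallai_identity[OF simple_graph_split_path] card_verts_split_path alpha_split_path
proof -
  \<comment> \<open>On each path, subtracting the half rounded up leaves the half rounded
    down.\<close>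
  have "k div 2 + (k + 1) div 2 = k" for k :: nat
    by linarith
  from this[of a] this[of "n - b"]
  show "a + (n - b) - ((a + 1) div 2 + (n - b + 1) div 2) = a div 2 + (n - b) div 2"
    by linarith
qed

end

section \<open>Stability of paths\<close>

theorem theorem7:
  fixes \<xi> :: "nat graph \<Rightarrow> nat"
  assumes "\<xi> \<in> {alpha, beta, chi, omega}"
  shows
    "(edge_stable \<xi> (path_graph 1) \<and> vertex_stable beta (path_graph 1) \<and>
        (\<forall>\<rho>\<in>{chi, alpha, omega}. \<not> vertex_stable \<rho> (path_graph 1))) \<and>
     (\<not> edge_stable \<xi> (path_graph 2) \<and> (\<forall>\<rho>\<in>{beta, chi, omega}. \<not> vertex_stable \<rho> (path_graph 2)) \<and>
        vertex_stable alpha (path_graph 2)) \<and>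
     (edge_stable \<xi> (path_graph 3) \<and> \<not> vertex_stable \<xi> (path_graph 3)) \<and>
     (\<forall>n\<ge>4.
        edge_stable chi (path_graph n) \<and> edge_stable omega (path_graph n) \<and>
        vertex_stable chi (path_graph n) \<and> vertex_stable omega (path_graph n) \<and>
        \<not> vertex_stable beta (path_graph n) \<and>
        (even n \<longrightarrow> \<not> edge_stable alpha (path_graph n) \<and> \<not> edge_stable beta (path_graph n) \<and>
           vertex_stable alpha (path_graph n)) \<and>
        (odd n \<longrightarrow> edge_stable alpha (path_graph n) \<and> edge_stable beta (path_graph n) \<and>
           \<not> vertex_stable alpha (path_graph n)))"
proof -
  note params = alpha_split_path beta_split_path chi_omega_split_path
  note stable = edge_stable_path_graph_iff vertex_stable_path_graph_iff
  \<comment> \<open>There is no edge to delete, and deleting the only vertex leaves the null graph: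
    \<open>beta\<close> stays 0, the others drop from 1 to 0.\<close>
  have P1: "edge_stable \<xi> (path_graph 1) \<and> vertex_stable beta (path_graph 1) \<and>
      (\<forall>\<rho>\<in>{chi, alpha, omega}. \<not> vertex_stable \<rho> (path_graph 1))"
    by (simp add: stable params)
  have set2: "{1..2::nat} = {1, 2}" and set3: "{1..3::nat} = {1, 2, 3}"
    by auto
  have lt2: "1 \<le> i \<and> i < 2 \<longleftrightarrow> i = 1" and lt3: "1 \<le> i \<and> i < 3 \<longleftrightarrow> i = 1 \<or> i = 2" for i :: nat
    by auto
  have P2: "\<not> edge_stable \<xi> (path_graph 2) \<and>
      (\<forall>\<rho>\<in>{beta, chi, omega}. \<not> vertex_stable \<rho> (path_graph 2)) \<and>
      vertex_stable alpha (path_graph 2)"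
    using assms unfolding stable set2 lt2 by (auto simp: params)
  have P3: "edge_stable \<xi> (path_graph 3) \<and> \<not> vertex_stable \<xi> (path_graph 3)"
    using assms unfolding stable set3 lt3 by (auto simp: params)
  have "edge_stable chi (path_graph n) \<and> edge_stable omega (path_graph n) \<and>
      vertex_stable chi (path_graph n) \<and> vertex_stable omega (path_graph n) \<and>
      \<not> vertex_stable beta (path_graph n) \<and>
      (even n \<longrightarrow> \<not> edge_stable alpha (path_graph n) \<and> \<not> edge_stable beta (path_graph n) \<and>
         vertex_stable alpha (path_graph n)) \<and>
      (odd n \<longrightarrow> edge_stable alpha (path_graph n) \<and> edge_stable beta (path_graph n) \<and>
         \<not> vertex_stable alpha (path_graph n))" if n: "4 \<le> n" for n
  proof (intro conjI impI)
    \<comment> \<open>At least three vertices remain on two paths, so one path still has an edge and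
      both values stay 2.\<close>
    show "edge_stable chi (path_graph n)" "edge_stable omega (path_graph n)"
      "vertex_stable chi (path_graph n)" "vertex_stable omega (path_graph n)"
      using n by (auto simp: stable params)
    \<comment> \<open>Deleting vertex 2 isolates vertex 1 and leaves a path on \<open>n - 2\<close>
      vertices, so \<open>beta\<close> drops by 1.\<close>
    have "beta (split_path (2 - 1) 2 n) \<noteq> beta (split_path n n n)"
      using n by (simp add: params)
    then show "\<not> vertex_stable beta (path_graph n)"
      unfolding stable using n by (intro notI) (drule bspec[of _ _ 2], auto)
  next
    assume "even n"
    \<comment> \<open>Deleting the first edge isolates vertex 1: for even \<open>n\<close>,
      \<open>alpha\<close> rises and \<open>beta\<close> drops by 1.\<close>
    then have "alpha (split_path 1 1 n) \<noteq> alpha (split_path n n n)"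
      "beta (split_path 1 1 n) \<noteq> beta (split_path n n n)"
      using n by (simp_all add: params) presburger+
    then show "\<not> edge_stable alpha (path_graph n)" "\<not> edge_stable beta (path_graph n)"
      unfolding stable using n by (auto intro!: exI[of _ 1])
    \<comment> \<open>The two paths have \<open>n - 1\<close> vertices in total, an odd number, so
      exactly one half is rounded up and the sum is \<open>n div 2\<close>.\<close>
    have "alpha (split_path (i - 1) i n) = alpha (split_path n n n)" if "i \<in> {1..n}" for i
      using that \<open>even n\<close> add_div_2_parity(1)[of i "n - i"] by (simp add: params)
    then show "vertex_stable alpha (path_graph n)"
      unfolding stable by blast
  next
    assume "odd n"
    \<comment> \<open>Of \<open>i\<close> and \<open>n - i\<close> exactly one is odd, so rounding
      occurs once, as on the whole path.\<close>
    then have "alpha (split_path i i n) = alpha (split_path n n n)"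
      "beta (split_path i i n) = beta (split_path n n n)" if "1 \<le> i \<and> i < n" for i
      using that add_div_2_parity(2,3)[of i "n - i"] by (simp_all add: params)
    then show "edge_stable alpha (path_graph n)" "edge_stable beta (path_graph n)"
      unfolding stable by blast+
    \<comment> \<open>Deleting an end vertex leaves a path of even order \<open>n - 1\<close>, whose
      \<open>alpha\<close> is smaller by 1.\<close>
    have "alpha (split_path (1 - 1) 1 n) \<noteq> alpha (split_path n n n)"
      using n \<open>odd n\<close> by (simp add: params)
    then show "\<not> vertex_stable alpha (path_graph n)"
      unfolding stable using n by (intro notI) (drule bspec[of _ _ 1], auto)
  qed
  with P1 P2 P3 show ?thesis
    by blast
qed

end
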